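(* Let $W$ be a Hilbert space, let $V\subset W$ be a finite-dimensional subspace with basis $\{\varphi_i\}_{i=1}^N$ and with a norm $\|\cdot\|$, and let $a:V\times V\to\mathbb{C}$ be a sesquilinear form with matrix $A\in\mathbb{C}^{N\times N}$, $A_{ij}=a(\varphi_j,\varphi_i)$. Assume that there is a constant $C_S>0$ such that for every $L\in W'$ the problem of finding $u\in V$ with $a(u,v)=L(v)$ for all $v\in V$ has a unique solution $u$, and this solution satisfies $\|u\|\le C_S\|L\|_{W'}$, where $C_S$ does not depend on $u$ or $L$. Let $\alpha,\alpha_W>0$ be constants such that $\alpha|\vec{x}_u|\le\|u\|$ and $\alpha_W|\vec{x}_u|\le\|u\|_W$ for all $u\in V$, and set $C_{2S}:=C_S(\alpha_W\alpha)^{-1}$. Then for every $\epsilon>0$, $$B\left(0,\frac{1}{C_{2S}}-\epsilon\right)\subset\Lambda_\epsilon^c .$$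
   Context: For $u\in V$, $\vec{x}_u\in\mathbb{C}^N$ denotes the coefficient vector with $u=\sum_{i=1}^N(\vec{x}_u)_i\varphi_i$. The form $a$ is linear in its first and antilinear in its second argument, so that $a(u,v)=\vec{x}_v^*A\vec{x}_u$. $W'$ is the space of (bounded) antilinear functionals $L:W\to\mathbb{C}$, with $\|L\|_{W'}:=\sup\{|L(w)| : w\in W,\ \|w\|_W=1\}$. $|\cdot|$ denotes the Euclidean norm of vectors and the spectral norm of matrices. The pseudospectrum is $\Lambda_\epsilon=\Lambda_\epsilon(A):=\{z\in\mathbb{C} : |(zI-A)^{-1}|\ge\epsilon^{-1}\}$, with the convention $|(zI-A)^{-1}|=\infty$ when $zI-A$ is singular; its complement is $\Lambda_\epsilon^c=\{z\in\mathbb{C} : |(zI-A)^{-1}|<\epsilon^{-1}\}$. $B(z_0,r):=\{z\in\mathbb{C} : |z-z_0|<r\}$ (empty if $r\le 0$). *)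

theory Defs
  imports "HOL-Analysis.Analysis"
begin

class complex_vector = real_vector +
  fixes scaleC :: "complex \<Rightarrow> 'a \<Rightarrow> 'a" (infixr "*\<^sub>C" 75)
  assumes scaleC_add_right: "c *\<^sub>C (x + y) = c *\<^sub>C x + c *\<^sub>C y"
    and scaleC_add_left: "(c + d) *\<^sub>C x = c *\<^sub>C x + d *\<^sub>C x"
    and scaleC_scaleC: "c *\<^sub>C d *\<^sub>C x = (c * d) *\<^sub>C x"
    and scaleC_one: "1 *\<^sub>C x = x"
    and scaleR_scaleC: "r *\<^sub>R x = complex_of_real r *\<^sub>C x"

global_interpretation complex_vector: vector_space "scaleC :: complex \<Rightarrow> 'a \<Rightarrow> 'a::complex_vector"
  defines cdependent = complex_vector.dependent
    and csubspace = complex_vector.subspace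
    and cspan = complex_vector.span
  by unfold_locales (simp_all add: scaleC_add_right scaleC_add_left scaleC_scaleC scaleC_one)

(* Completeness, and the metric and topology of the norm, are inherited from banach. *)
class complex_hilbert_space = complex_vector + banach +
  fixes cinner :: "'a \<Rightarrow> 'a \<Rightarrow> complex"
  assumes cinner_commute: "cinner x y = cnj (cinner y x)"
    and cinner_add_left: "cinner (x + y) z = cinner x z + cinner y z"
    and cinner_scaleC_left: "cinner (c *\<^sub>C x) y = c * cinner x y"
    and cinner_self_nonneg: "0 \<le> Re (cinner x x)"
    and cinner_self_eq_0_iff: "cinner x x = 0 \<longleftrightarrow> x = 0"
    and norm_eq_sqrt_cinner: "norm x = sqrt (Re (cinner x x))"

definition cnorm_on :: "'w::complex_vector set \<Rightarrow> ('w \<Rightarrow> real) \<Rightarrow> bool" where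
  "cnorm_on V n \<longleftrightarrow>
     (\<forall>u\<in>V. 0 \<le> n u \<and> (n u = 0 \<longleftrightarrow> u = 0)) \<and>
     (\<forall>u\<in>V. \<forall>c. n (c *\<^sub>C u) = cmod c * n u) \<and>
     (\<forall>u\<in>V. \<forall>v\<in>V. n (u + v) \<le> n u + n v)"

definition sesquilinear_on :: "'w::complex_vector set \<Rightarrow> ('w \<Rightarrow> 'w \<Rightarrow> complex) \<Rightarrow> bool" where
  "sesquilinear_on V a \<longleftrightarrow>
     (\<forall>u\<in>V. \<forall>u'\<in>V. \<forall>v\<in>V. a (u + u') v = a u v + a u' v) \<and>
     (\<forall>c. \<forall>u\<in>V. \<forall>v\<in>V. a (c *\<^sub>C u) v = c * a u v) \<and>
     (\<forall>u\<in>V. \<forall>v\<in>V. \<forall>v'\<in>V. a u (v + v') = a u v + a u v') \<and>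
     (\<forall>c. \<forall>u\<in>V. \<forall>v\<in>V. a u (c *\<^sub>C v) = cnj c * a u v)"

definition antilinear_dual :: "('w::complex_hilbert_space \<Rightarrow> complex) set" where
  "antilinear_dual = {L.
     (\<forall>x y. L (x + y) = L x + L y) \<and>
     (\<forall>c x. L (c *\<^sub>C x) = cnj c * L x) \<and>
     (\<exists>K. \<forall>x. cmod (L x) \<le> K * norm x)}"

definition dual_norm :: "('w::complex_hilbert_space \<Rightarrow> complex) \<Rightarrow> real" where
  "dual_norm L = Sup {cmod (L w) | w. norm w = 1}"

definition cbasis_of :: "'w::complex_vector set \<Rightarrow> ('n::finite \<Rightarrow> 'w) \<Rightarrow> bool" where
  "cbasis_of V \<phi> \<longleftrightarrow> inj \<phi> \<and> \<not> cdependent (range \<phi>) \<and> cspan (range \<phi>) = V"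

definition coeff_vec :: "('n::finite \<Rightarrow> 'w::complex_vector) \<Rightarrow> 'w \<Rightarrow> complex ^ 'n" where
  "coeff_vec \<phi> u = (THE x. u = (\<Sum>i\<in>UNIV. (x $ i) *\<^sub>C \<phi> i))"

(* The arguments are swapped: row i belongs to the test function, so that
   a u v equals the conjugate transpose of coeff_vec v, times the matrix, times coeff_vec u. *)
definition form_matrix :: "('w \<Rightarrow> 'w \<Rightarrow> complex) \<Rightarrow> ('n::finite \<Rightarrow> 'w) \<Rightarrow> complex ^ 'n ^ 'n" where
  "form_matrix a \<phi> = (\<chi> i j. a (\<phi> j) (\<phi> i))"

definition spectral_norm :: "complex ^ 'n::finite ^ 'n \<Rightarrow> real" where
  "spectral_norm B = onorm (\<lambda>x. B *v x)"

(* mat z is z times the identity matrix. *)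
definition resolvent_norm :: "complex ^ 'n::finite ^ 'n \<Rightarrow> complex \<Rightarrow> ereal" where
  "resolvent_norm A z =
     (if invertible (mat z - A) then ereal (spectral_norm (matrix_inv (mat z - A))) else \<infinity>)"

definition pseudospectrum :: "real \<Rightarrow> complex ^ 'n::finite ^ 'n \<Rightarrow> complex set" where
  "pseudospectrum \<epsilon> A = {z. resolvent_norm A z \<ge> ereal (inverse \<epsilon>)}"

end

theory Submission
  imports Defs
begin

text \<open>
  The hypothesis on \<open>a\<close> is a stability estimate in terms of functionals; the
  claim is about the matrix \<open>A\<close>. The bridge is the lower bound \<open>\<bar>x\<bar> \<le> C\<^sub>2\<^sub>S \<bar>A x\<bar>\<close> for
  every coefficient vector \<open>x\<close> (\<open>form_matrix_lower_bound\<close>): if \<open>u\<close> has coefficients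
  \<open>x\<close>, then \<open>u\<close> solves \<open>a(u,v) = L(v)\<close> on \<open>V\<close> for any \<open>L\<close> in \<open>W'\<close> whose values on the
  basis are the entries of \<open>A x\<close>, so \<open>\<alpha> \<bar>x\<bar> \<le> \<parallel>u\<parallel> \<le> C\<^sub>S \<parallel>L\<parallel>\<close>, and it remains to choose \<open>L\<close>
  with \<open>\<parallel>L\<parallel> \<le> \<bar>A x\<bar> / \<alpha>\<^sub>W\<close>. On \<open>V\<close> this bound is the inequality of Cauchy and Schwarz
  for coefficient vectors together with \<open>\<alpha>\<^sub>W \<bar>x\<^sub>v\<bar> \<le> \<parallel>v\<parallel>\<^sub>W\<close>, but the stability hypothesis
  asks for a functional on all of \<open>W\<close>. An extension without increase of the norm is
  \<open>L = \<langle>w, \<cdot>\<rangle>\<close> with \<open>w\<close> in \<open>V\<close>; such a \<open>w\<close> exists because the Gram matrix of a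
  basis is invertible (\<open>exists_representer\<close>).

  The rest is perturbation: \<open>\<bar>(z I - A) x\<bar> \<ge> \<bar>A x\<bar> - \<bar>z\<bar> \<bar>x\<bar> \<ge> (1/C\<^sub>2\<^sub>S - \<bar>z\<bar>) \<bar>x\<bar>\<close>, and for
  \<open>\<bar>z\<bar> < 1/C\<^sub>2\<^sub>S - \<epsilon>\<close> the factor exceeds \<open>\<epsilon>\<close>. Hence \<open>z I - A\<close> is invertible with an inverse
  of spectral norm below \<open>1/\<epsilon>\<close> (\<open>resolvent_norm_le\<close>).
\<close>

section \<open>Complex inner products\<close>

lemma cinner_add_right: "cinner x (y + z) = cinner x y + cinner x z"
  by (metis cinner_add_left cinner_commute complex_cnj_add)

lemma cinner_scaleC_right: "cinner x (c *\<^sub>C y) = cnj c * cinner x y"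
  by (metis cinner_commute cinner_scaleC_left complex_cnj_mult)

lemma cinner_zero_right [simp]: "cinner x 0 = 0"
  using cinner_add_right[of x 0 0] by simp

lemma cinner_self_eq_norm: "cinner x x = complex_of_real ((norm x)\<^sup>2)"
proof -
  have "Im (cinner x x) = 0"
    using arg_cong[OF cinner_commute[of x x], of Im] by simp
  moreover have "Re (cinner x x) = (norm x)\<^sup>2"
    by (simp add: norm_eq_sqrt_cinner cinner_self_nonneg)
  ultimately show ?thesis by (simp add: complex_eq_iff)
qed

text \<open>The usual argument: \<open>\<parallel>y\<parallel>\<^sup>2 x - \<langle>x,y\<rangle> y\<close> has a nonnegative square norm,
  which expands to \<open>\<parallel>y\<parallel>\<^sup>2 (\<parallel>x\<parallel>\<^sup>2 \<parallel>y\<parallel>\<^sup>2 - \<bar>\<langle>x,y\<rangle>\<bar>\<^sup>2)\<close>.\<close>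

lemma cmod_cinner_le: "cmod (cinner x y) \<le> norm x * norm y"
proof (cases "y = 0")
  case False
  define p where "p = (norm y)\<^sup>2"
  define q where "q = cinner x y"
  define t where "t = complex_of_real p *\<^sub>C x + (- q) *\<^sub>C y"
  have yx: "cinner y x = cnj q" unfolding q_def by (rule cinner_commute)
  have xx: "cinner x x = of_real ((norm x)\<^sup>2)" and yy: "cinner y y = of_real p"
    by (simp_all only: cinner_self_eq_norm p_def)
  have "cinner t t = of_real p * of_real p * of_real ((norm x)\<^sup>2) - of_real p * (q * cnj q)"
    by (simp only: t_def cinner_add_left cinner_add_right cinner_scaleC_left cinner_scaleC_right
        xx yy yx q_def[symmetric] complex_cnj_complex_of_real
        complex_cnj_minus) (simp add: algebra_simps)
  also have "\<dots> = of_real (p * (p * (norm x)\<^sup>2 - (cmod q)\<^sup>2))"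
    by (simp only: complex_norm_square[symmetric]) (simp add: algebra_simps)
  finally have "0 \<le> p * (p * (norm x)\<^sup>2 - (cmod q)\<^sup>2)"
    using cinner_self_nonneg[of t] by simp
  moreover have "p > 0" using False by (simp add: p_def)
  ultimately have "(cmod q)\<^sup>2 \<le> p * (norm x)\<^sup>2"
    by (simp add: zero_le_mult_iff)
  then have "(cmod q)\<^sup>2 \<le> (norm x * norm y)\<^sup>2"
    by (simp add: p_def power_mult_distrib mult.commute)
  then show ?thesis unfolding q_def by (rule power2_le_imp_le) simp
qed simp

lemma cinner_in_antilinear_dual: "cinner w \<in> antilinear_dual"
  unfolding antilinear_dual_def
  by (auto simp: cinner_add_right cinner_scaleC_right intro: cmod_cinner_le)

text \<open>A space other than \<open>{0}\<close> is required here: otherwise there are no unit vectors and the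
  supremum in the dual norm is that of the empty set.\<close>

lemma dual_norm_cinner_le:
  fixes w v\<^sub>0 :: "'w::complex_hilbert_space"
  assumes "v\<^sub>0 \<noteq> 0"
  shows "dual_norm (cinner w) \<le> norm w"
  unfolding dual_norm_def
proof (rule cSup_least)
  have "norm ((1 / norm v\<^sub>0) *\<^sub>R v\<^sub>0) = 1" using assms by simp
  then show "{cmod (cinner w v) |v. norm v = 1} \<noteq> {}" by blast
next
  fix r assume "r \<in> {cmod (cinner w v) |v. norm v = 1}"
  then obtain v where "r = cmod (cinner w v)" and "norm v = 1" by blast
  then show "r \<le> norm w" using cmod_cinner_le[of w v] by simp
qed

lemma cmod_sum_mult_cnj_le:
  fixes x y :: "complex ^ 'n"
  shows "cmod (\<Sum>i\<in>UNIV. x $ i * cnj (y $ i)) \<le> norm x * norm y"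
proof -
  have "cmod (\<Sum>i\<in>UNIV. x $ i * cnj (y $ i)) \<le> (\<Sum>i\<in>UNIV. \<bar>cmod (x $ i)\<bar> * \<bar>cmod (y $ i)\<bar>)"
    by (rule order_trans[OF norm_sum]) (simp add: norm_mult)
  also have "\<dots> \<le> norm x * norm y"
    unfolding norm_vec_def by (rule L2_set_mult_ineq)
  finally show ?thesis .
qed

section \<open>Coordinates with respect to a basis\<close>

definition lincomb :: "('n::finite \<Rightarrow> 'w::complex_vector) \<Rightarrow> complex ^ 'n \<Rightarrow> 'w" where
  "lincomb \<phi> x = (\<Sum>i\<in>UNIV. (x $ i) *\<^sub>C \<phi> i)"

lemma lincomb_eq_0D:
  assumes "cbasis_of V \<phi>" and "lincomb \<phi> x = 0"
  shows "x = 0"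
proof -
  have inj: "inj \<phi>" and ind: "\<not> cdependent (range \<phi>)"
    using assms(1) by (auto simp: cbasis_of_def)
  have "(\<Sum>v\<in>range \<phi>. (x $ inv \<phi> v) *\<^sub>C v) = 0"
    using assms(2) inj by (simp add: sum.reindex lincomb_def)
  then have "x $ inv \<phi> (\<phi> i) = 0" for i
    by (rule complex_vector.independentD[OF ind finite_imageI[OF finite] subset_refl]) simp
  then show ?thesis using inj by (simp add: vec_eq_iff)
qed

lemma lincomb_diff: "lincomb \<phi> (x - y) = lincomb \<phi> x - lincomb \<phi> y"
  by (simp add: lincomb_def complex_vector.scale_left_diff_distrib sum_subtractf)

lemma lincomb_eq_iff:
  assumes "cbasis_of V \<phi>"
  shows "lincomb \<phi> x = lincomb \<phi> y \<longleftrightarrow> x = y"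
  using lincomb_eq_0D[OF assms, of "x - y"] by (auto simp: lincomb_diff)

lemma coeff_vec_lincomb:
  assumes "cbasis_of V \<phi>"
  shows "coeff_vec \<phi> (lincomb \<phi> x) = x"
  unfolding coeff_vec_def lincomb_def[symmetric] lincomb_eq_iff[OF assms] by simp

lemma lincomb_in_span:
  assumes "cbasis_of V \<phi>"
  shows "lincomb \<phi> x \<in> V"
  using assms unfolding cbasis_of_def lincomb_def
  by (auto intro!: complex_vector.span_sum complex_vector.span_scale intro: complex_vector.span_base)

lemma span_eq_lincomb:
  assumes "cbasis_of V \<phi>" and "v \<in> V"
  obtains x where "v = lincomb \<phi> x"
proof -
  have inj: "inj \<phi>" and "v \<in> cspan (range \<phi>)"
    using assms by (auto simp: cbasis_of_def)
  then obtain c where "v = (\<Sum>b\<in>range \<phi>. c b *\<^sub>C b)"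
    by (auto simp: complex_vector.span_finite)
  then have "v = lincomb \<phi> (\<chi> i. c (\<phi> i))"
    using inj by (simp add: lincomb_def sum.reindex)
  then show ?thesis by (rule that)
qed

lemma basis_vector_in_span:
  assumes "cbasis_of V \<phi>"
  shows "\<phi> i \<in> V"
  using assms unfolding cbasis_of_def by (auto intro: complex_vector.span_base)

lemma basis_vector_nonzero:
  assumes "cbasis_of V \<phi>"
  shows "\<phi> i \<noteq> 0"
  using assms complex_vector.dependent_zero[of "range \<phi>"]
  unfolding cbasis_of_def by (metis rangeI)

text \<open>The form is sesquilinear on \<open>V\<close> only, so partial sums must be kept inside \<open>V\<close>
  during the induction.\<close>

lemma sesquilinear_on_sum_left:
  assumes V: "csubspace V" and a: "sesquilinear_on V a" and v: "v \<in> V"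
    and f: "\<And>i. f i \<in> V"
  shows "a (\<Sum>i\<in>I. c i *\<^sub>C f i) v = (\<Sum>i\<in>I. c i * a (f i) v)"
proof (induction I rule: infinite_finite_induct)
  have "a 0 v = 0 * a 0 v"
    using a v complex_vector.subspace_0[OF V] unfolding sesquilinear_on_def
    by (metis complex_vector.scale_zero_left)
  then have zero: "a 0 v = 0" by simp
  { case (infinite I) then show ?case using zero by simp }
  { case empty then show ?case using zero by simp }
  case (insert j I)
  have "(\<Sum>i\<in>I. c i *\<^sub>C f i) \<in> V" and "c j *\<^sub>C f j \<in> V" and "f j \<in> V"
    using f by (auto intro!: complex_vector.subspace_sum[OF V] complex_vector.subspace_scale[OF V])
  then show ?case using insert a v by (simp add: sesquilinear_on_def)
qed

lemma sesquilinear_on_sum_right: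
  assumes V: "csubspace V" and a: "sesquilinear_on V a" and u: "u \<in> V"
    and f: "\<And>i. f i \<in> V"
  shows "a u (\<Sum>i\<in>I. c i *\<^sub>C f i) = (\<Sum>i\<in>I. cnj (c i) * a u (f i))"
proof -
  \<comment> \<open>Conjugating and exchanging the arguments gives again a sesquilinear form.\<close>
  have "sesquilinear_on V (\<lambda>v u. cnj (a u v))"
    using a by (simp add: sesquilinear_on_def)
  from arg_cong[OF sesquilinear_on_sum_left[OF V this u f, where c = c and I = I], of cnj]
  show ?thesis by simp
qed

lemma sesquilinear_on_lincomb:
  assumes V: "csubspace V" and \<phi>: "cbasis_of V \<phi>" and a: "sesquilinear_on V a"
  shows "a (lincomb \<phi> x) (lincomb \<phi> y)
           = (\<Sum>i\<in>UNIV. (form_matrix a \<phi> *v x) $ i * cnj (y $ i))"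
proof -
  note in_V = basis_vector_in_span[OF \<phi>]
  have "a (lincomb \<phi> x) (\<phi> i) = (form_matrix a \<phi> *v x) $ i" for i
    by (simp add: lincomb_def sesquilinear_on_sum_left[OF V a] in_V form_matrix_def
        matrix_vector_mult_def mult.commute)
  then show ?thesis
    unfolding lincomb_def[of \<phi> y]
    by (simp add: sesquilinear_on_sum_right[OF V a lincomb_in_span[OF \<phi>]] in_V mult.commute)
qed

section \<open>Representing coefficient functionals\<close>

lemma matrix_injective_imp_invertible:
  fixes B :: "'a::field ^ 'n ^ 'n"
  assumes "\<And>x. B *v x = 0 \<Longrightarrow> x = 0"
  shows "invertible B"
proof -
  have "inj ((*v) B)"
  proof (rule injI)
    fix x y assume "B *v x = B *v y"
    then show "x = y" using assms[of "x - y"] by (simp add: matrix_vector_mult_diff_distrib)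
  qed
  then show ?thesis
    by (simp add: invertible_left_inverse matrix_left_invertible_injective)
qed

lemma matrix_inv_right:
  fixes B :: "'a::semiring_1 ^ 'n ^ 'm"
  assumes "invertible B"
  shows "B ** matrix_inv B = mat 1"
  using assms unfolding invertible_def matrix_inv_def by (rule someI2_ex) simp

text \<open>
  A concrete form of the Riesz representation theorem on \<open>V\<close>: the coefficients \<open>y\<close> of the
  representer solve a linear system with the Gram matrix of the basis, which is the matrix
  of the inner product as a sesquilinear form. This matrix is injective because the inner
  product is definite. The norm bound follows by testing the functional with the
  representer itself.
\<close>

lemma exists_representer:
  fixes V :: "'w::complex_hilbert_space set" and b :: "complex ^ 'n"
  assumes V: "csubspace V" and \<phi>: "cbasis_of V \<phi>"
    and "\<alpha>\<^sub>W > 0" and lower: "\<forall>u\<in>V. \<alpha>\<^sub>W * norm (coeff_vec \<phi> u) \<le> norm u"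
  obtains w where "\<And>y. cinner w (lincomb \<phi> y) = (\<Sum>i\<in>UNIV. b $ i * cnj (y $ i))"
    and "norm w \<le> norm b / \<alpha>\<^sub>W"
proof -
  define G where "G = form_matrix (cinner :: 'w \<Rightarrow> _) \<phi>"
  have "sesquilinear_on V cinner"
    by (simp add: sesquilinear_on_def cinner_add_left cinner_add_right
        cinner_scaleC_left cinner_scaleC_right)
  note gram = sesquilinear_on_lincomb[OF V \<phi> this, folded G_def]
  have "invertible G"
  proof (rule matrix_injective_imp_invertible)
    fix x assume "G *v x = 0"
    then have "cinner (lincomb \<phi> x) (lincomb \<phi> x) = 0" by (simp add: gram)
    then show "x = 0" using lincomb_eq_0D[OF \<phi>] by (simp add: cinner_self_eq_0_iff)
  qed
  then have Gx: "G *v (matrix_inv G *v b) = b"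
    by (simp add: matrix_vector_mul_assoc matrix_inv_right)
  define x where "x = matrix_inv G *v b"
  define w where "w = lincomb \<phi> x"
  have w: "cinner w (lincomb \<phi> y) = (\<Sum>i\<in>UNIV. b $ i * cnj (y $ i))" for y
    using gram[of x y] Gx by (simp add: w_def x_def)
  have "(norm w)\<^sup>2 = cmod (cinner w w)" by (simp add: cinner_self_eq_norm norm_power)
  also have "\<dots> \<le> norm b * norm x"
    using w[of x] cmod_sum_mult_cnj_le[of b x] by (simp add: w_def)
  also have "\<dots> \<le> norm b * (norm w / \<alpha>\<^sub>W)"
  proof (rule mult_left_mono)
    show "norm x \<le> norm w / \<alpha>\<^sub>W"
      using lower lincomb_in_span[OF \<phi>, of x] \<open>\<alpha>\<^sub>W > 0\<close>
      by (auto simp: w_def coeff_vec_lincomb[OF \<phi>] field_simps)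
  qed simp
  finally have "norm w * norm w \<le> norm w * (norm b / \<alpha>\<^sub>W)"
    by (simp add: power2_eq_square mult.commute)
  then have "norm w \<le> norm b / \<alpha>\<^sub>W"
    using \<open>\<alpha>\<^sub>W > 0\<close> by (cases "w = 0") (simp_all del: times_divide_eq_right)
  with w show ?thesis by (rule that)
qed

section \<open>From stability of the form to the resolvent\<close>

text \<open>The function \<open>u\<close> with coefficients \<open>x\<close> is the solution for the functional
  represented by \<open>A x\<close>, so the stability estimate can be read as one on \<open>x\<close>.\<close>

lemma form_matrix_lower_bound:
  fixes V :: "'w::complex_hilbert_space set" and \<phi> :: "'n::finite \<Rightarrow> 'w"
  assumes V: "csubspace V" and \<phi>: "cbasis_of V \<phi>" and a: "sesquilinear_on V a"
    and "C\<^sub>S > 0"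
    and stable: "\<And>L u. L \<in> antilinear_dual \<Longrightarrow> u \<in> V \<Longrightarrow> \<forall>v\<in>V. a u v = L v \<Longrightarrow>
                   norm_V u \<le> C\<^sub>S * dual_norm L"
    and "\<alpha> > 0" and "\<alpha>\<^sub>W > 0"
    and lower: "\<forall>u\<in>V. \<alpha> * norm (coeff_vec \<phi> u) \<le> norm_V u"
    and lowerW: "\<forall>u\<in>V. \<alpha>\<^sub>W * norm (coeff_vec \<phi> u) \<le> norm u"
  shows "norm x \<le> C\<^sub>S * inverse (\<alpha>\<^sub>W * \<alpha>) * norm (form_matrix a \<phi> *v x)"
proof -
  define b where "b = form_matrix a \<phi> *v x"
  define u where "u = lincomb \<phi> x"
  obtain w where w: "\<And>y. cinner w (lincomb \<phi> y) = (\<Sum>i\<in>UNIV. b $ i * cnj (y $ i))"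
    and w_le: "norm w \<le> norm b / \<alpha>\<^sub>W"
    using exists_representer[OF V \<phi> \<open>\<alpha>\<^sub>W > 0\<close> lowerW, of b] by blast
  have u: "u \<in> V" unfolding u_def by (rule lincomb_in_span[OF \<phi>])
  have "a u v = cinner w v" if "v \<in> V" for v
  proof -
    obtain y where "v = lincomb \<phi> y" using \<open>v \<in> V\<close> by (rule span_eq_lincomb[OF \<phi>])
    then show ?thesis
      by (simp add: u_def w b_def sesquilinear_on_lincomb[OF V \<phi> a])
  qed
  then have "norm_V u \<le> C\<^sub>S * dual_norm (cinner w)"
    using stable[OF cinner_in_antilinear_dual u] by blast
  also have "\<dots> \<le> C\<^sub>S * (norm b / \<alpha>\<^sub>W)"
    using dual_norm_cinner_le[OF basis_vector_nonzero[OF \<phi>], of w] w_le \<open>C\<^sub>S > 0\<close>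
    by (intro mult_left_mono) linarith+
  finally have "\<alpha> * norm x \<le> C\<^sub>S * (norm b / \<alpha>\<^sub>W)"
    using lower u by (force simp: u_def coeff_vec_lincomb[OF \<phi>])
  then show ?thesis using \<open>\<alpha> > 0\<close> \<open>\<alpha>\<^sub>W > 0\<close> by (simp add: b_def field_simps)
qed

lemma resolvent_norm_le:
  fixes A :: "complex ^ 'n::finite ^ 'n"
  assumes "\<delta> > 0" and lower: "\<And>x. \<delta> * norm x \<le> norm ((mat z - A) *v x)"
  shows "resolvent_norm A z \<le> ereal (1 / \<delta>)"
proof -
  let ?M = "mat z - A"
  have inv: "invertible ?M"
  proof (rule matrix_injective_imp_invertible)
    fix x assume "?M *v x = 0"
    then have "\<delta> * norm x \<le> 0" using lower[of x] by simp
    then show "x = 0" using \<open>\<delta> > 0\<close> by (simp add: mult_le_0_iff)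
  qed
  have "norm (matrix_inv ?M *v y) \<le> 1 / \<delta> * norm y" for y
    using lower[of "matrix_inv ?M *v y"] inv \<open>\<delta> > 0\<close>
    by (simp add: matrix_vector_mul_assoc matrix_inv_right field_simps)
  then have "spectral_norm (matrix_inv ?M) \<le> 1 / \<delta>"
    unfolding spectral_norm_def using \<open>\<delta> > 0\<close> by (intro onorm_bound) simp_all
  then show ?thesis using inv by (simp add: resolvent_norm_def)
qed

lemma norm_mat_mult_vec:
  fixes x :: "complex ^ 'n::finite"
  shows "norm (mat z *v x) = cmod z * norm x"
proof -
  have "(mat z *v x) $ i = z * x $ i" for i
  proof -
    have "(mat z *v x) $ i = (\<Sum>j\<in>UNIV. if i = j then z * x $ j else 0)"
      unfolding matrix_vector_mult_def mat_def vec_lambda_beta by (rule sum.cong) simp_all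
    then show ?thesis by simp
  qed
  then show ?thesis
    by (simp add: norm_vec_def norm_mult L2_set_right_distrib)
qed

text \<open>Perturbing \<open>A\<close> by \<open>z I\<close> costs at most \<open>\<bar>z\<bar>\<close> in the lower bound \<open>1/C\<close>.\<close>

lemma ball_subset_compl_pseudospectrum:
  fixes A :: "complex ^ 'n::finite ^ 'n"
  assumes "C > 0" and "\<epsilon> > 0" and lower: "\<And>x. norm x \<le> C * norm (A *v x)"
  shows "ball 0 (1 / C - \<epsilon>) \<subseteq> - pseudospectrum \<epsilon> A"
proof
  fix z :: complex assume "z \<in> ball 0 (1 / C - \<epsilon>)"
  define \<delta> where "\<delta> = 1 / C - cmod z"
  have "\<delta> > \<epsilon>" using \<open>z \<in> _\<close> by (simp add: \<delta>_def)
  have "\<delta> * norm x \<le> norm ((mat z - A) *v x)" for x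
  proof -
    have "\<delta> * norm x \<le> norm (A *v x) - cmod z * norm x"
      using lower[of x] \<open>C > 0\<close> by (simp add: \<delta>_def field_simps)
    also have "\<dots> \<le> norm ((mat z - A) *v x)"
      using norm_triangle_ineq2[of "A *v x" "mat z *v x"]
      by (simp add: norm_mat_mult_vec matrix_vector_mult_diff_rdistrib norm_minus_commute)
    finally show ?thesis .
  qed
  then have "resolvent_norm A z \<le> ereal (1 / \<delta>)"
    using \<open>\<delta> > \<epsilon>\<close> \<open>\<epsilon> > 0\<close> by (intro resolvent_norm_le) simp_all
  also have "\<dots> < ereal (inverse \<epsilon>)"
    using \<open>\<delta> > \<epsilon>\<close> \<open>\<epsilon> > 0\<close> by (simp add: field_simps)
  finally show "z \<in> - pseudospectrum \<epsilon> A"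
    by (simp add: pseudospectrum_def)
qed

theorem theorem3p1:
  fixes V :: "'w::complex_hilbert_space set"
    and \<phi> :: "'n::finite \<Rightarrow> 'w"
    and norm_V :: "'w \<Rightarrow> real"
    and a :: "'w \<Rightarrow> 'w \<Rightarrow> complex"
    and A :: "complex ^ 'n ^ 'n"
    and C\<^sub>S \<alpha> \<alpha>\<^sub>W C\<^sub>2\<^sub>S \<epsilon> :: real
  assumes "csubspace V"
    and "cbasis_of V \<phi>"
    and "cnorm_on V norm_V"
    and "sesquilinear_on V a"
    and "A = form_matrix a \<phi>"
    and "C\<^sub>S > 0"
    and "\<forall>L \<in> antilinear_dual.
           (\<exists>!u. u \<in> V \<and> (\<forall>v\<in>V. a u v = L v)) \<and>
           (\<forall>u\<in>V. (\<forall>v\<in>V. a u v = L v) \<longrightarrow> norm_V u \<le> C\<^sub>S * dual_norm L)"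
    and "\<alpha> > 0" and "\<alpha>\<^sub>W > 0"
    and "\<forall>u\<in>V. \<alpha> * norm (coeff_vec \<phi> u) \<le> norm_V u"
    and "\<forall>u\<in>V. \<alpha>\<^sub>W * norm (coeff_vec \<phi> u) \<le> norm u"
    and "C\<^sub>2\<^sub>S = C\<^sub>S * inverse (\<alpha>\<^sub>W * \<alpha>)"
    and "\<epsilon> > 0"
  shows "ball 0 (1 / C\<^sub>2\<^sub>S - \<epsilon>) \<subseteq> - pseudospectrum \<epsilon> A"
proof -
  have "norm x \<le> C\<^sub>2\<^sub>S * norm (A *v x)" for x
    unfolding \<open>A = _\<close> \<open>C\<^sub>2\<^sub>S = _\<close>
    using assms(7) by (intro form_matrix_lower_bound[where V = V and norm_V = norm_V] assms) blast
  moreover have "C\<^sub>2\<^sub>S > 0" using assms(6,8,9,12) by simp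
  ultimately show ?thesis using \<open>\<epsilon> > 0\<close> by (intro ball_subset_compl_pseudospectrum)
qed

end
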